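(* Let $D=(X,\models,A)$ and $E=(Y,\models,B)$ be fuzzy topological systems. Then their product $D\times E=(X\times Y,\models^*,A\otimes B)$, where $$gr\Big((x,y)\models^*\bigvee_i(a_i\otimes b_i)\Big)=\bigvee_i\big(gr(x\models a_i)\wedge gr(y\models b_i)\big),$$ is a fuzzy topological system.
   Context: A frame is a poset with arbitrary joins and finite meets (including the empty ones) in which binary meets distribute over arbitrary joins; a frame homomorphism preserves arbitrary joins and finite meets. A fuzzy topological system is a triple $(X,\models,A)$, where $X$ is a non-empty set, $A$ is a frame and $\models$ is a fuzzy relation from $X$ to $A$, i.e. a function $(x,a)\mapsto gr(x\models a)\in[0,1]$, such that $gr(x\models\bigwedge S)=\inf\{gr(x\models s): s\in S\}$ for every finite $S\subseteq A$ and $gr(x\models\bigvee S)=\sup\{gr(x\models s): s\in S\}$ for every $S\subseteq A$ (with $\inf\emptyset=1$, $\sup\emptyset=0$). In $[0,1]$, $\wedge$ and $\bigvee$ are minimum and supremum. For frames $A,B$, the tensor product (frame coproduct) $A\otimes B$ is the frame generated by symbols $a\otimes b$ ($a\in A$, $b\in B$) subject to the relations $\bigwedge_i(a_i\otimes b_i)=(\bigwedge_i a_i)\otimes(\bigwedge_i b_i)$ for finite families, $\bigvee_i(a_i\otimes b)=(\bigvee_i a_i)\otimes b$ and $\bigvee_i(a\otimes b_i)=a\otimes(\bigvee_i b_i)$ for arbitrary families. Every element of $A\otimes B$ can be written as $\bigvee_i(a_i\otimes b_i)$ for some $a_i\in A$, $b_i\in B$. *)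

theory Defs
  imports Complex_Main "HOL-Library.FSet"
begin

section \<open>Frames\<close>

text \<open>The class \<^class>\<open>complete_distrib_lattice\<close> is complete distributivity, which is
  strictly stronger than the frame law.\<close>

class frame = complete_lattice +
  assumes inf_Sup_frame: "inf a (Sup S) = (SUP s\<in>S. inf a s)"

definition frame_hom :: "('a::frame \<Rightarrow> 'b::frame) \<Rightarrow> bool" where
  "frame_hom h \<longleftrightarrow>
     (\<forall>S. h (Sup S) = (SUP s\<in>S. h s)) \<and>
     (\<forall>S. finite S \<longrightarrow> h (Inf S) = (INF s\<in>S. h s))"


section \<open>The free frame on a set of generators\<close>

text \<open>A finite set \<^term>\<open>F\<close> of generators stands for the formal meet of its elements, so an
  upward closed collection of finite sets is a formal join of finite meets.\<close>

typedef 'g free_frame = "{U :: 'g fset set. \<forall>F G. F \<in> U \<longrightarrow> F |\<subseteq>| G \<longrightarrow> G \<in> U}"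
  by auto

setup_lifting type_definition_free_frame

instantiation free_frame :: (type) frame
begin

lift_definition less_eq_free_frame :: "'a free_frame \<Rightarrow> 'a free_frame \<Rightarrow> bool" is "(\<subseteq>)" .
lift_definition less_free_frame :: "'a free_frame \<Rightarrow> 'a free_frame \<Rightarrow> bool" is "(\<subset>)" .
lift_definition inf_free_frame :: "'a free_frame \<Rightarrow> 'a free_frame \<Rightarrow> 'a free_frame" is "(\<inter>)" by blast
lift_definition sup_free_frame :: "'a free_frame \<Rightarrow> 'a free_frame \<Rightarrow> 'a free_frame" is "(\<union>)" by blast
lift_definition Inf_free_frame :: "'a free_frame set \<Rightarrow> 'a free_frame" is "Inter" by blast
lift_definition Sup_free_frame :: "'a free_frame set \<Rightarrow> 'a free_frame" is "Union" by blast
lift_definition bot_free_frame :: "'a free_frame" is "{}" by blast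
lift_definition top_free_frame :: "'a free_frame" is "UNIV" by blast

instance
proof
  fix x y z :: "'a free_frame" and S :: "'a free_frame set"
  note reps = less_eq_free_frame.rep_eq less_free_frame.rep_eq inf_free_frame.rep_eq
    sup_free_frame.rep_eq Inf_free_frame.rep_eq Sup_free_frame.rep_eq
  show "x < y \<longleftrightarrow> x \<le> y \<and> \<not> y \<le> x" unfolding reps by blast
  show "x \<le> x" unfolding reps by blast
  show "x \<le> y \<Longrightarrow> y \<le> z \<Longrightarrow> x \<le> z" unfolding reps by blast
  show "x \<le> y \<Longrightarrow> y \<le> x \<Longrightarrow> x = y" unfolding reps Rep_free_frame_inject[symmetric] by blast
  show "inf x y \<le> x" "inf x y \<le> y" unfolding reps by blast+
  show "x \<le> y \<Longrightarrow> x \<le> z \<Longrightarrow> x \<le> inf y z" unfolding reps by blast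
  show "x \<le> sup x y" "y \<le> sup x y" unfolding reps by blast+
  show "y \<le> x \<Longrightarrow> z \<le> x \<Longrightarrow> sup y z \<le> x" unfolding reps by blast
  show "x \<in> S \<Longrightarrow> Inf S \<le> x" unfolding reps by blast
  show "(\<And>x. x \<in> S \<Longrightarrow> z \<le> x) \<Longrightarrow> z \<le> Inf S" unfolding reps by blast
  show "x \<in> S \<Longrightarrow> x \<le> Sup S" unfolding reps by blast
  show "(\<And>x. x \<in> S \<Longrightarrow> x \<le> z) \<Longrightarrow> Sup S \<le> z" unfolding reps by blast
  show "Inf {} = (top :: 'a free_frame)" by transfer simp
  show "Sup {} = (bot :: 'a free_frame)" by transfer simp
  show "inf x (Sup S) = (SUP s\<in>S. inf x s)"
    unfolding Rep_free_frame_inject[symmetric] reps image_image by blast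
qed

end

lift_definition gen :: "'g \<Rightarrow> 'g free_frame" is "\<lambda>g. {F. g |\<in>| F}"
  by auto


section \<open>The tensor product\<close>

text \<open>The least frame congruence on the free frame over the symbols \<^term>\<open>(a, b)\<close> that contains
  the defining relations. In \<open>meet\<close> the set \<^term>\<open>S\<close> may be empty, which gives the relation
  identifying the top element with the generator of the two top elements.\<close>

inductive tensor_eq ::
  "('a::frame \<times> 'b::frame) free_frame \<Rightarrow> ('a \<times> 'b) free_frame \<Rightarrow> bool" where
  meet: "finite S \<Longrightarrow> tensor_eq (INF p\<in>S. gen p) (gen (INF p\<in>S. fst p, INF p\<in>S. snd p))"
| join_left: "tensor_eq (SUP a\<in>S. gen (a, b)) (gen (Sup S, b))"
| join_right: "tensor_eq (SUP b\<in>S. gen (a, b)) (gen (a, Sup S))"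
| refl: "tensor_eq u u"
| sym: "tensor_eq u v \<Longrightarrow> tensor_eq v u"
| trans: "tensor_eq u v \<Longrightarrow> tensor_eq v w \<Longrightarrow> tensor_eq u w"
| inf_cong: "tensor_eq u u' \<Longrightarrow> tensor_eq v v' \<Longrightarrow> tensor_eq (inf u v) (inf u' v')"
| Sup_cong: "(\<And>u v. (u, v) \<in> P \<Longrightarrow> tensor_eq u v) \<Longrightarrow> tensor_eq (Sup (fst ` P)) (Sup (snd ` P))"

quotient_type (overloaded) ('a, 'b) tensor = "('a::frame \<times> 'b::frame) free_frame" / tensor_eq
  by (rule equivpI) (auto intro!: reflpI sympI transpI intro: tensor_eq.refl tensor_eq.sym tensor_eq.trans)

lift_definition tensor :: "'a::frame \<Rightarrow> 'b::frame \<Rightarrow> ('a, 'b) tensor"  (infixl \<open>\<otimes>\<close> 75)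
  is "\<lambda>a b. gen (a, b)" .

lemma tensor_eq_SUP:
  assumes "\<And>i. i \<in> I \<Longrightarrow> tensor_eq (f i) (g i)"
  shows "tensor_eq (SUP i\<in>I. f i) (SUP i\<in>I. g i)"
proof -
  have "tensor_eq (Sup (fst ` ((\<lambda>i. (f i, g i)) ` I))) (Sup (snd ` ((\<lambda>i. (f i, g i)) ` I)))"
    by (rule tensor_eq.Sup_cong) (use assms in auto)
  then show ?thesis by (simp add: image_image)
qed

lemma tensor_eq_rep_abs: "tensor_eq (rep_tensor (abs_tensor u)) u"
  by (rule Quotient3_rep_abs[OF Quotient3_tensor]) (rule tensor_eq.refl)

lemma abs_rep_tensor [simp]: "abs_tensor (rep_tensor t) = t"
  by (rule Quotient3_abs_rep[OF Quotient3_tensor])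

lemma abs_tensor_eq_iff: "abs_tensor u = abs_tensor v \<longleftrightarrow> tensor_eq u v"
  by (rule tensor.abs_eq_iff)

instantiation tensor :: (frame, frame) frame
begin

lift_definition inf_tensor :: "('a, 'b) tensor \<Rightarrow> ('a, 'b) tensor \<Rightarrow> ('a, 'b) tensor" is inf
  by (rule tensor_eq.inf_cong)
definition Sup_tensor :: "('a, 'b) tensor set \<Rightarrow> ('a, 'b) tensor" where
  "Sup_tensor T = abs_tensor (SUP t\<in>T. rep_tensor t)"
definition less_eq_tensor :: "('a, 'b) tensor \<Rightarrow> ('a, 'b) tensor \<Rightarrow> bool" where
  "less_eq_tensor t u \<longleftrightarrow> inf t u = t"
definition less_tensor :: "('a, 'b) tensor \<Rightarrow> ('a, 'b) tensor \<Rightarrow> bool" where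
  "less_tensor t u \<longleftrightarrow> t \<le> u \<and> \<not> u \<le> t"
definition sup_tensor :: "('a, 'b) tensor \<Rightarrow> ('a, 'b) tensor \<Rightarrow> ('a, 'b) tensor" where
  "sup_tensor t u = Sup {t, u}"
definition Inf_tensor :: "('a, 'b) tensor set \<Rightarrow> ('a, 'b) tensor" where
  "Inf_tensor T = Sup {u. \<forall>t\<in>T. u \<le> t}"
definition bot_tensor :: "('a, 'b) tensor" where
  "bot_tensor = Sup {}"
definition top_tensor :: "('a, 'b) tensor" where
  "top_tensor = Inf {}"

lemma SUP_abs_tensor:
  "(SUP i\<in>I. abs_tensor (f i)) = abs_tensor (SUP i\<in>I. f i)"
  unfolding Sup_tensor_def image_image abs_tensor_eq_iff
  by (rule tensor_eq_SUP) (rule tensor_eq_rep_abs)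

instance
proof
  note inf_abs = inf_tensor.abs_eq
  have comm: "inf x y = inf y x" for x y :: "('a, 'b) tensor"
    by transfer (simp add: inf_commute tensor_eq.refl)
  have assoc: "inf (inf x y) z = inf x (inf y z)" for x y z :: "('a, 'b) tensor"
    by transfer (simp add: inf_assoc tensor_eq.refl)
  have idem: "inf x x = x" for x :: "('a, 'b) tensor"
    by transfer (simp add: tensor_eq.refl)
  have distrib: "inf x (Sup S) = (SUP s\<in>S. inf x s)" for x :: "('a, 'b) tensor" and S
  proof -
    have "inf x (Sup S) = inf (abs_tensor (rep_tensor x)) (abs_tensor (SUP s\<in>S. rep_tensor s))"
      by (simp add: Sup_tensor_def)
    also have "\<dots> = abs_tensor (SUP s\<in>S. inf (rep_tensor x) (rep_tensor s))"
      unfolding inf_abs by (simp add: inf_Sup_frame image_image)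
    also have "\<dots> = (SUP s\<in>S. abs_tensor (inf (rep_tensor x) (rep_tensor s)))"
      by (rule SUP_abs_tensor[symmetric])
    also have "\<dots> = (SUP s\<in>S. inf x s)"
      by (simp add: inf_abs[symmetric])
    finally show ?thesis .
  qed
  have upper: "x \<le> Sup S" if "x \<in> S" for x :: "('a, 'b) tensor" and S
  proof -
    have "inf (rep_tensor x) (SUP s\<in>S. rep_tensor s) = rep_tensor x"
      by (rule inf_absorb1) (rule SUP_upper[OF that])
    then have "inf (abs_tensor (rep_tensor x)) (Sup S) = abs_tensor (rep_tensor x)"
      unfolding Sup_tensor_def inf_abs by simp
    then show ?thesis by (simp add: less_eq_tensor_def)
  qed
  have least: "Sup S \<le> z" if "\<And>x. x \<in> S \<Longrightarrow> x \<le> z" for z :: "('a, 'b) tensor" and S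
  proof -
    have "inf z s = s" if "s \<in> S" for s
      using \<open>\<And>x. x \<in> S \<Longrightarrow> x \<le> z\<close>[OF that] comm[of z s] by (simp add: less_eq_tensor_def)
    then have "inf z (Sup S) = Sup S"
      unfolding distrib by simp
    then show ?thesis using comm[of z "Sup S"] by (simp add: less_eq_tensor_def)
  qed
  have order_trans': "x \<le> z" if "x \<le> y" "y \<le> z" for x y z :: "('a, 'b) tensor"
    using that assoc[of x y z] by (simp add: less_eq_tensor_def)
  fix x y z :: "('a, 'b) tensor" and S :: "('a, 'b) tensor set"
  show "x < y \<longleftrightarrow> x \<le> y \<and> \<not> y \<le> x" by (rule less_tensor_def)
  show "x \<le> x" by (simp add: less_eq_tensor_def idem)
  show "x \<le> y \<Longrightarrow> y \<le> z \<Longrightarrow> x \<le> z" by (rule order_trans')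
  show "x \<le> y \<Longrightarrow> y \<le> x \<Longrightarrow> x = y" using comm[of x y] by (simp add: less_eq_tensor_def)
  show "inf x y \<le> x" using assoc[of x x y] comm[of x "inf x y"] by (simp add: less_eq_tensor_def idem)
  show "inf x y \<le> y" using assoc[of x y y] by (simp add: less_eq_tensor_def idem)
  show "x \<le> y \<Longrightarrow> x \<le> z \<Longrightarrow> x \<le> inf y z" using assoc[of x y z] by (simp add: less_eq_tensor_def)
  show "x \<le> sup x y" "y \<le> sup x y" unfolding sup_tensor_def by (rule upper, simp)+
  show "y \<le> x \<Longrightarrow> z \<le> x \<Longrightarrow> sup y z \<le> x" unfolding sup_tensor_def by (rule least) blast
  show "x \<in> S \<Longrightarrow> Inf S \<le> x" unfolding Inf_tensor_def by (rule least) blast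
  show "(\<And>x. x \<in> S \<Longrightarrow> z \<le> x) \<Longrightarrow> z \<le> Inf S" unfolding Inf_tensor_def by (rule upper) blast
  show "x \<in> S \<Longrightarrow> x \<le> Sup S" by (rule upper)
  show "(\<And>x. x \<in> S \<Longrightarrow> x \<le> z) \<Longrightarrow> Sup S \<le> z" by (rule least)
  show "Inf {} = (top :: ('a, 'b) tensor)" by (simp add: top_tensor_def)
  show "Sup {} = (bot :: ('a, 'b) tensor)" by (simp add: bot_tensor_def)
  show "inf x (Sup S) = (SUP s\<in>S. inf x s)" by (rule distrib)
qed

end

lemma top_tensor_abs: "top = abs_tensor top"
proof (rule antisym)
  have "inf t (abs_tensor top) = t" for t :: "('a, 'b) tensor"
    using inf_tensor.abs_eq[of "rep_tensor t" top] by simp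
  from this[of top] show "(top :: ('a, 'b) tensor) \<le> abs_tensor top"
    by (simp only: le_iff_inf)
qed simp

lemma frame_hom_Sup: "frame_hom h \<Longrightarrow> h (Sup S) = (SUP s\<in>S. h s)"
  unfolding frame_hom_def by (elim conjE) (rule spec)

lemma frame_hom_Inf: "frame_hom h \<Longrightarrow> finite S \<Longrightarrow> h (Inf S) = (INF s\<in>S. h s)"
  unfolding frame_hom_def by (elim conjE) (drule spec, erule (1) mp)

lemma frame_hom_inf: "frame_hom h \<Longrightarrow> h (inf x y) = inf (h x) (h y)"
  using frame_hom_Inf[of h "{x, y}"] by simp

lemma frame_hom_top: "frame_hom h \<Longrightarrow> h top = top"
  using frame_hom_Inf[of h "{}"] by simp

lemma frame_homI:
  assumes Sup: "\<And>S. h (Sup S) = (SUP s\<in>S. h s)"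
    and top: "h top = top"
    and inf: "\<And>x y. h (inf x y) = inf (h x) (h y)"
  shows "frame_hom h"
proof -
  have "h (Inf S) = (INF s\<in>S. h s)" if "finite S" for S
    using that by induction (simp_all add: top inf)
  then show ?thesis by (simp add: frame_hom_def Sup)
qed

lemma frame_hom_abs_tensor:
  "frame_hom (abs_tensor :: ('a::frame \<times> 'b::frame) free_frame \<Rightarrow> ('a, 'b) tensor)"
proof -
  have "abs_tensor (Sup S) = (SUP s\<in>S. abs_tensor s)" for S :: "('a \<times> 'b) free_frame set"
    using SUP_abs_tensor[of "\<lambda>s. s" S] by simp
  then show ?thesis
    by (rule frame_homI) (simp_all only: top_tensor_abs inf_tensor.abs_eq)
qed

lemma tensor_abs: "a \<otimes> b = abs_tensor (gen (a, b))"
  by (rule tensor.abs_eq)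

lemma tensor_INF:
  fixes a :: "'i \<Rightarrow> 'a::frame" and b :: "'i \<Rightarrow> 'b::frame"
  assumes "finite I"
  shows "(INF i\<in>I. a i \<otimes> b i) = (INF i\<in>I. a i) \<otimes> (INF i\<in>I. b i)"
proof -
  let ?S = "(\<lambda>i. (a i, b i)) ` I"
  have "(INF i\<in>I. a i \<otimes> b i) = abs_tensor (INF p\<in>?S. gen p)"
    using frame_hom_Inf[OF frame_hom_abs_tensor, of "gen ` ?S"] assms
    by (simp add: tensor_abs image_image)
  also have "\<dots> = abs_tensor (gen (INF p\<in>?S. fst p, INF p\<in>?S. snd p))"
    unfolding abs_tensor_eq_iff using assms by (intro tensor_eq.meet) simp
  finally show ?thesis by (simp add: tensor_abs image_image)
qed

lemma Sup_tensor_left: "(SUP a\<in>S. a \<otimes> b) = Sup S \<otimes> b"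
proof -
  have "(SUP a\<in>S. a \<otimes> b) = abs_tensor (SUP a\<in>S. gen (a, b))"
    unfolding tensor_abs by (rule SUP_abs_tensor)
  then show ?thesis by (simp add: tensor_abs abs_tensor_eq_iff tensor_eq.join_left)
qed

lemma Sup_tensor_right: "(SUP b\<in>S. a \<otimes> b) = a \<otimes> Sup S"
proof -
  have "(SUP b\<in>S. a \<otimes> b) = abs_tensor (SUP b\<in>S. gen (a, b))"
    unfolding tensor_abs by (rule SUP_abs_tensor)
  then show ?thesis by (simp add: tensor_abs abs_tensor_eq_iff tensor_eq.join_right)
qed

lemma free_frame_normal_form:
  "u = (SUP F\<in>Rep_free_frame u. INF g\<in>fset F. gen g)"
  by transfer (force simp: less_eq_fset.rep_eq)

theorem tensor_SUP_ex:
  obtains S where "(t :: ('a::frame, 'b::frame) tensor) = (SUP (a, b)\<in>S. a \<otimes> b)"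
proof
  let ?U = "Rep_free_frame (rep_tensor t)"
  let ?m = "\<lambda>F :: ('a \<times> 'b) fset. (INF p\<in>fset F. fst p, INF p\<in>fset F. snd p)"
  have "t = abs_tensor (SUP F\<in>?U. INF g\<in>fset F. gen g)"
    using free_frame_normal_form[of "rep_tensor t"] by simp
  also have "\<dots> = abs_tensor (SUP F\<in>?U. gen (?m F))"
    unfolding abs_tensor_eq_iff by (intro tensor_eq_SUP tensor_eq.meet) simp
  also have "\<dots> = (SUP F\<in>?U. abs_tensor (gen (?m F)))"
    by (rule SUP_abs_tensor[symmetric])
  also have "\<dots> = (SUP (a, b)\<in>?m ` ?U. a \<otimes> b)"
    by (simp add: tensor_abs image_image)
  finally show "t = (SUP (a, b)\<in>?m ` ?U. a \<otimes> b)" .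
qed

text \<open>The universal property of the presentation, for an arbitrary target frame.\<close>

definition free_ext :: "('g \<Rightarrow> 'c::frame) \<Rightarrow> 'g free_frame \<Rightarrow> 'c" where
  "free_ext f u = (SUP F\<in>Rep_free_frame u. INF g\<in>fset F. f g)"

lemma free_ext_gen: "free_ext f (gen g) = f g"
proof (rule antisym)
  show "free_ext f (gen g) \<le> f g"
    unfolding free_ext_def by (auto simp: gen.rep_eq intro!: SUP_least INF_lower)
  have "(INF h\<in>fset {|g|}. f h) \<le> free_ext f (gen g)"
    unfolding free_ext_def by (rule SUP_upper) (simp add: gen.rep_eq)
  then show "f g \<le> free_ext f (gen g)" by simp
qed

lemma SUP_inf_SUP_frame:
  "inf (SUP i\<in>I. f i) (SUP j\<in>J. g j) = (SUP i\<in>I. SUP j\<in>J. inf (f i) (g j :: 'c::frame))"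
proof -
  have "inf (SUP i\<in>I. f i) (SUP j\<in>J. g j) = (SUP j\<in>J. inf (g j) (SUP i\<in>I. f i))"
    by (simp add: inf_Sup_frame image_image inf_commute)
  also have "\<dots> = (SUP j\<in>J. SUP i\<in>I. inf (f i) (g j))"
    by (simp add: inf_Sup_frame image_image inf_commute)
  also have "\<dots> = (SUP i\<in>I. SUP j\<in>J. inf (f i) (g j))"
    by (rule SUP_commute)
  finally show ?thesis .
qed

lemma frame_hom_free_ext: "frame_hom (free_ext (f :: 'g \<Rightarrow> 'c::frame))"
proof -
  let ?m = "\<lambda>F. INF g\<in>fset F. f g"
  have "free_ext f (Sup S) = (SUP s\<in>S. free_ext f s)" for S
    unfolding free_ext_def Sup_free_frame.rep_eq
    by (rule antisym) (auto intro!: SUP_least intro: SUP_upper2 SUP_upper)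
  moreover have "free_ext f top = top"
  proof -
    have "?m {||} \<le> free_ext f top"
      unfolding free_ext_def by (rule SUP_upper) (simp add: top_free_frame.rep_eq)
    then show ?thesis by (simp add: top_unique)
  qed
  moreover have "free_ext f (inf u v) = inf (free_ext f u) (free_ext f v)" for u v
  proof (rule antisym)
    show "free_ext f (inf u v) \<le> inf (free_ext f u) (free_ext f v)"
      unfolding free_ext_def inf_free_frame.rep_eq by (auto intro!: SUP_least SUP_upper)
    have "inf (?m F) (?m G) \<le> free_ext f (inf u v)"
      if "F \<in> Rep_free_frame u" "G \<in> Rep_free_frame v" for F G
    proof -
      have "F |\<union>| G \<in> Rep_free_frame u" "F |\<union>| G \<in> Rep_free_frame v"
        using Rep_free_frame[of u] Rep_free_frame[of v] that by blast+
      then have "?m (F |\<union>| G) \<le> free_ext f (inf u v)"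
        unfolding free_ext_def by (intro SUP_upper) (simp add: inf_free_frame.rep_eq)
      then show ?thesis by (simp add: INF_union)
    qed
    then show "inf (free_ext f u) (free_ext f v) \<le> free_ext f (inf u v)"
      unfolding free_ext_def[of f u] free_ext_def[of f v] SUP_inf_SUP_frame
      by (auto intro!: SUP_least)
  qed
  ultimately show ?thesis by (rule frame_homI)
qed

theorem tensor_universal:
  fixes f :: "'a::frame \<Rightarrow> 'b::frame \<Rightarrow> 'c::frame"
  assumes meet: "\<And>S :: ('a \<times> 'b) set. finite S \<Longrightarrow>
      (INF (a, b)\<in>S. f a b) = f (INF p\<in>S. fst p) (INF p\<in>S. snd p)"
    and left: "\<And>S b. (SUP a\<in>S. f a b) = f (Sup S) b"
    and right: "\<And>S a. (SUP b\<in>S. f a b) = f a (Sup S)"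
  shows "\<exists>!h. frame_hom h \<and> (\<forall>a b. h (a \<otimes> b) = f a b)"
proof (rule ex_ex1I)
  let ?e = "free_ext (\<lambda>p. f (fst p) (snd p))"
  have e: "frame_hom ?e" by (rule frame_hom_free_ext)
  have eSup: "?e (Sup S) = (SUP s\<in>S. ?e s)" and eInf: "finite S \<Longrightarrow> ?e (Inf S) = (INF s\<in>S. ?e s)" for S
    by (rule frame_hom_Sup[OF e], rule frame_hom_Inf[OF e])
  have resp: "?e u = ?e v" if "tensor_eq u v" for u v
    using that
  proof induction
    case (meet S)
    then show ?case using assms(1)[of S]
      by (simp add: eInf image_image free_ext_gen split_def)
  next
    case (join_left S b)
    then show ?case using left by (simp add: eSup image_image free_ext_gen)
  next
    case (join_right a S)
    then show ?case using right by (simp add: eSup image_image free_ext_gen)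
  next
    case (inf_cong u u' v v')
    then show ?case using e by (simp add: frame_hom_inf)
  next
    case (Sup_cong P)
    then have "(\<lambda>p. ?e (fst p)) ` P = (\<lambda>p. ?e (snd p)) ` P"
      by (intro image_cong) auto
    then show ?case by (simp add: eSup image_image)
  qed auto
  define h where "h t = ?e (rep_tensor t)" for t
  have habs: "h (abs_tensor u) = ?e u" for u
    unfolding h_def by (rule resp) (rule tensor_eq_rep_abs)
  have "h (Sup S) = (SUP s\<in>S. h s)" for S
    unfolding Sup_tensor_def habs eSup by (simp add: image_image h_def)
  moreover have "h top = top"
    unfolding top_tensor_abs habs by (rule frame_hom_top[OF e])
  moreover have "h (inf x y) = inf (h x) (h y)" for x y
    using habs[of "inf (rep_tensor x) (rep_tensor y)"]
    by (simp add: inf_tensor.abs_eq[symmetric] frame_hom_inf[OF e] h_def[symmetric])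
  ultimately have "frame_hom h" by (rule frame_homI)
  moreover have "h (a \<otimes> b) = f a b" for a b
    by (simp add: tensor_abs habs free_ext_gen)
  ultimately show "\<exists>h. frame_hom h \<and> (\<forall>a b. h (a \<otimes> b) = f a b)" by blast
next
  fix h k :: "('a, 'b) tensor \<Rightarrow> 'c"
  assume h: "frame_hom h \<and> (\<forall>a b. h (a \<otimes> b) = f a b)" and k: "frame_hom k \<and> (\<forall>a b. k (a \<otimes> b) = f a b)"
  show "h = k"
  proof
    fix t :: "('a, 'b) tensor"
    obtain S where t: "t = (SUP (a, b)\<in>S. a \<otimes> b)" by (rule tensor_SUP_ex)
    show "h t = k t"
      using h k unfolding t by (simp add: frame_hom_Sup image_image split_def)
  qed
qed


section \<open>Fuzzy topological systems\<close>

text \<open>Suprema and infima in the unit interval; on the reals, \<^term>\<open>Sup {}\<close> and \<^term>\<open>Inf {}\<close>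
  are not 0 and 1.\<close>

definition Sup01 :: "real set \<Rightarrow> real" where
  "Sup01 S = (if S = {} then 0 else Sup S)"

definition Inf01 :: "real set \<Rightarrow> real" where
  "Inf01 S = (if S = {} then 1 else Inf S)"

text \<open>The underlying frame of the system is the whole type \<^typ>\<open>'a\<close>; \<^term>\<open>gr x a\<close> is the degree to
  which \<^term>\<open>x\<close> satisfies \<^term>\<open>a\<close>, and is only constrained for \<^term>\<open>x \<in> X\<close>.\<close>

definition fuzzy_topological_system :: "'x set \<Rightarrow> ('x \<Rightarrow> 'a::frame \<Rightarrow> real) \<Rightarrow> bool" where
  "fuzzy_topological_system X gr \<longleftrightarrow>
     X \<noteq> {} \<and>
     (\<forall>x\<in>X. \<forall>a. gr x a \<in> {0..1}) \<and>
     (\<forall>x\<in>X. \<forall>S. finite S \<longrightarrow> gr x (Inf S) = Inf01 (gr x ` S)) \<and>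
     (\<forall>x\<in>X. \<forall>S. gr x (Sup S) = Sup01 (gr x ` S))"

text \<open>The prescription for the product relation determines a value only if every way of writing
  \<^term>\<open>t\<close> as a join of elements \<^term>\<open>a \<otimes> b\<close> yields the same one; otherwise the result of
  \<open>THE\<close> is unspecified. A family is given by its set of pairs.\<close>

definition prod_gr ::
  "('x \<Rightarrow> 'a::frame \<Rightarrow> real) \<Rightarrow> ('y \<Rightarrow> 'b::frame \<Rightarrow> real) \<Rightarrow> 'x \<times> 'y \<Rightarrow> ('a, 'b) tensor \<Rightarrow> real" where
  "prod_gr gr1 gr2 = (\<lambda>(x, y) t. THE r. \<forall>S. t = (SUP (a, b)\<in>S. a \<otimes> b) \<longrightarrow>
     r = Sup01 ((\<lambda>(a, b). min (gr1 x a) (gr2 y b)) ` S))"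

end

theory Submission
  imports Defs
begin

text \<open>
  The unit interval is itself a frame, and a fuzzy topological system on \<^term>\<open>X\<close> is nothing but a
  non-empty family, indexed by \<^term>\<open>X\<close>, of frame homomorphisms into it, that is, of
  \<open>[0,1]\<close>-valued points of the underlying frame (\<open>fuzzy_topological_system_iff_frame_homs\<close>).
  Two such points \<open>g\<close> of \<open>A\<close> and \<open>k\<close> of \<open>B\<close> determine, by the universal property of the coproduct,
  a unique point \<open>h\<close> of \<open>A \<otimes> B\<close> with \<open>h (a \<otimes> b) = g a \<and> k b\<close>
  (\<open>tensor_copairing\<close>). As \<open>h\<close> preserves joins, its value at a join of elements \<open>a \<otimes> b\<close> is the
  supremum of the numbers \<open>g a \<and> k b\<close>, whichever way that join is written.

  This settles the one real difficulty, the well-definedness of the product relation: every element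
  of the tensor product is such a join, so the prescription for the product relation is met by \<open>h\<close>
  and by nothing else (\<open>prod_gr_unique\<close>). The product relation at \<^term>\<open>(x, y)\<close> is therefore a frame
  homomorphism, and the product is a fuzzy topological system by the same characterisation.
\<close>

typedef unit_interval = "{0..1::real}" morphisms degree to_unit
  by (rule exI[of _ 0]) simp

setup_lifting type_definition_unit_interval

lemma Sup01_upper: "S \<subseteq> {0..1} \<Longrightarrow> r \<in> S \<Longrightarrow> r \<le> Sup01 S"
  unfolding Sup01_def by (auto intro!: cSup_upper bdd_aboveI[of _ 1])

lemma Sup01_least: "0 \<le> c \<Longrightarrow> (\<And>r. r \<in> S \<Longrightarrow> r \<le> c) \<Longrightarrow> Sup01 S \<le> c"
  unfolding Sup01_def by (auto intro!: cSup_least)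

lemma Inf01_lower: "S \<subseteq> {0..1} \<Longrightarrow> r \<in> S \<Longrightarrow> Inf01 S \<le> r"
  unfolding Inf01_def by (auto intro!: cInf_lower bdd_belowI[of _ 0])

lemma Inf01_greatest: "c \<le> 1 \<Longrightarrow> (\<And>r. r \<in> S \<Longrightarrow> c \<le> r) \<Longrightarrow> c \<le> Inf01 S"
  unfolding Inf01_def by (auto intro!: cInf_greatest)

lemma Sup01_in_unit:
  assumes "S \<subseteq> {0..1}" shows "Sup01 S \<in> {0..1}"
proof (cases "S = {}")
  case False
  then obtain r where "r \<in> S" by blast
  with assms have "0 \<le> Sup01 S" using Sup01_upper[OF assms, of r] by force
  moreover have "Sup01 S \<le> 1" using assms by (intro Sup01_least) auto
  ultimately show ?thesis by simp
qed (simp add: Sup01_def)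

lemma Inf01_in_unit:
  assumes "S \<subseteq> {0..1}" shows "Inf01 S \<in> {0..1}"
proof (cases "S = {}")
  case False
  then obtain r where "r \<in> S" by blast
  with assms have "Inf01 S \<le> 1" using Inf01_lower[OF assms, of r] by force
  moreover have "0 \<le> Inf01 S" using assms by (intro Inf01_greatest) auto
  ultimately show ?thesis by simp
qed (simp add: Inf01_def)

instantiation unit_interval :: complete_linorder
begin

lift_definition less_eq_unit_interval :: "unit_interval \<Rightarrow> unit_interval \<Rightarrow> bool" is "(\<le>)" .
lift_definition less_unit_interval :: "unit_interval \<Rightarrow> unit_interval \<Rightarrow> bool" is "(<)" .
lift_definition inf_unit_interval :: "unit_interval \<Rightarrow> unit_interval \<Rightarrow> unit_interval" is min by auto
lift_definition sup_unit_interval :: "unit_interval \<Rightarrow> unit_interval \<Rightarrow> unit_interval" is max by auto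
definition Inf_unit_interval :: "unit_interval set \<Rightarrow> unit_interval" where
  "Inf_unit_interval S = to_unit (Inf01 (degree ` S))"
definition Sup_unit_interval :: "unit_interval set \<Rightarrow> unit_interval" where
  "Sup_unit_interval S = to_unit (Sup01 (degree ` S))"
lift_definition bot_unit_interval :: unit_interval is 0 by simp
lift_definition top_unit_interval :: unit_interval is 1 by simp

lemma degree_Sup: "degree (Sup S) = Sup01 (degree ` S)"
  unfolding Sup_unit_interval_def
  by (intro to_unit_inverse Sup01_in_unit) (use degree in blast)

lemma degree_Inf: "degree (Inf S) = Inf01 (degree ` S)"
  unfolding Inf_unit_interval_def
  by (intro to_unit_inverse Inf01_in_unit) (use degree in blast)

instance
proof
  fix x y z :: unit_interval and S :: "unit_interval set"
  note reps = less_eq_unit_interval.rep_eq less_unit_interval.rep_eq inf_unit_interval.rep_eq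
    sup_unit_interval.rep_eq degree_Inf degree_Sup
  have unit: "degree ` S \<subseteq> {0..1}" "0 \<le> degree z" "degree z \<le> 1"
    using degree degree[of z] by auto
  show "x < y \<longleftrightarrow> x \<le> y \<and> \<not> y \<le> x" unfolding reps by linarith
  show "x \<le> x" unfolding reps by simp
  show "x \<le> y \<Longrightarrow> y \<le> z \<Longrightarrow> x \<le> z" unfolding reps by simp
  show "x \<le> y \<Longrightarrow> y \<le> x \<Longrightarrow> x = y" unfolding reps degree_inject[symmetric] by simp
  show "x \<le> y \<or> y \<le> x" unfolding reps by linarith
  show "inf x y \<le> x" "inf x y \<le> y" unfolding reps by simp_all
  show "x \<le> y \<Longrightarrow> x \<le> z \<Longrightarrow> x \<le> inf y z" unfolding reps by simp
  show "x \<le> sup x y" "y \<le> sup x y" unfolding reps by simp_all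
  show "y \<le> x \<Longrightarrow> z \<le> x \<Longrightarrow> sup y z \<le> x" unfolding reps by simp
  show "x \<in> S \<Longrightarrow> Inf S \<le> x" unfolding reps using unit by (intro Inf01_lower) auto
  show "(\<And>x. x \<in> S \<Longrightarrow> z \<le> x) \<Longrightarrow> z \<le> Inf S" unfolding reps using unit by (intro Inf01_greatest) auto
  show "x \<in> S \<Longrightarrow> x \<le> Sup S" unfolding reps using unit by (intro Sup01_upper) auto
  show "(\<And>x. x \<in> S \<Longrightarrow> x \<le> z) \<Longrightarrow> Sup S \<le> z" unfolding reps using unit by (intro Sup01_least) auto
  show "Inf {} = (top :: unit_interval)"
    by (simp add: degree_inject[symmetric] degree_Inf top_unit_interval.rep_eq Inf01_def)
  show "Sup {} = (bot :: unit_interval)"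
    by (simp add: degree_inject[symmetric] degree_Sup bot_unit_interval.rep_eq Sup01_def)
qed

end

instance unit_interval :: frame
  by standard (rule inf_Sup)

text \<open>Infima and suprema in the unit interval are \<^const>\<open>Inf01\<close> and \<^const>\<open>Sup01\<close>, with the values
  1 and 0 on the empty set, so the two axioms on \<^term>\<open>gr x\<close> say exactly that it preserves finite
  meets and arbitrary joins.\<close>

lemma fuzzy_topological_system_iff_frame_homs:
  "fuzzy_topological_system X gr \<longleftrightarrow>
     X \<noteq> {} \<and> (\<forall>x\<in>X. \<exists>h. frame_hom h \<and> (\<forall>a. gr x a = degree (h a)))"
proof (intro iffI conjI ballI)
  fix x assume sys: "fuzzy_topological_system X gr" and x: "x \<in> X"
  define h where "h a = to_unit (gr x a)" for a
  have gr: "degree (h a) = gr x a" for a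
    using sys x unfolding fuzzy_topological_system_def h_def by (intro to_unit_inverse) blast
  have "h (Sup S) = (SUP s\<in>S. h s)" for S
    using sys x unfolding fuzzy_topological_system_def degree_inject[symmetric] degree_Sup
    by (simp add: image_image gr)
  moreover have "h (Inf S) = (INF s\<in>S. h s)" if "finite S" for S
    using sys x that unfolding fuzzy_topological_system_def degree_inject[symmetric] degree_Inf
    by (simp add: image_image gr)
  ultimately show "\<exists>h. frame_hom h \<and> (\<forall>a. gr x a = degree (h a))"
    unfolding frame_hom_def using gr by metis
next
  assume "X \<noteq> {} \<and> (\<forall>x\<in>X. \<exists>h. frame_hom h \<and> (\<forall>a. gr x a = degree (h a)))"
  then obtain h where X: "X \<noteq> {}" and h: "\<And>x. x \<in> X \<Longrightarrow> frame_hom (h x)"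
    and gr: "\<And>x a. x \<in> X \<Longrightarrow> gr x a = degree (h x a)" by metis
  then show "fuzzy_topological_system X gr"
    unfolding fuzzy_topological_system_def
    using degree by (auto simp: frame_hom_Sup frame_hom_Inf degree_Sup degree_Inf image_image)
qed (simp add: fuzzy_topological_system_def)

text \<open>The map \<^term>\<open>\<lambda>a b. inf (g a) (k b)\<close> respects the defining relations of the tensor product:
  it preserves finite meets because meets commute with meets, and joins in each variable by the
  frame law in the target.\<close>

lemma tensor_copairing:
  fixes g :: "'a::frame \<Rightarrow> 'c::frame" and k :: "'b::frame \<Rightarrow> 'c"
  assumes g: "frame_hom g" and k: "frame_hom k"
  obtains h where "frame_hom h" "\<And>a b. h (a \<otimes> b) = inf (g a) (k b)"
proof -
  have "\<exists>!h. frame_hom h \<and> (\<forall>a b. h (a \<otimes> b) = inf (g a) (k b))"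
  proof (rule tensor_universal)
    fix S :: "('a \<times> 'b) set" assume "finite S"
    then show "(INF (a, b)\<in>S. inf (g a) (k b)) = inf (g (INF p\<in>S. fst p)) (k (INF p\<in>S. snd p))"
      by (simp add: frame_hom_Inf[OF g] frame_hom_Inf[OF k] image_image split_def INF_inf_distrib)
  next
    fix S :: "'a set" and b
    show "(SUP a\<in>S. inf (g a) (k b)) = inf (g (Sup S)) (k b)"
      by (simp add: frame_hom_Sup[OF g] inf_Sup_frame image_image inf_commute[of _ "k b"])
  next
    fix S :: "'b set" and a
    show "(SUP b\<in>S. inf (g a) (k b)) = inf (g a) (k (Sup S))"
      by (simp add: frame_hom_Sup[OF k] inf_Sup_frame image_image)
  qed
  then show ?thesis using that by blast
qed

text \<open>Every way of writing \<^term>\<open>t\<close> as a join yields \<^term>\<open>degree (h t)\<close>, because \<^term>\<open>h\<close>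
  preserves that join. Conversely \<^term>\<open>t\<close> is such a join in at least one way, without which the
  condition on the value would be vacuous and the value undetermined.\<close>

lemma prod_gr_unique:
  fixes h :: "('a::frame, 'b::frame) tensor \<Rightarrow> unit_interval"
  assumes h: "frame_hom h" and h_tensor: "\<And>a b. degree (h (a \<otimes> b)) = min (gr1 x a) (gr2 y b)"
  shows "prod_gr gr1 gr2 (x, y) t = degree (h t)"
proof -
  have val: "degree (h (SUP (a, b)\<in>S. a \<otimes> b)) = Sup01 ((\<lambda>(a, b). min (gr1 x a) (gr2 y b)) ` S)" for S
    by (simp add: frame_hom_Sup[OF h] degree_Sup image_image split_def h_tensor)
  obtain S where S: "t = (SUP (a, b)\<in>S. a \<otimes> b)" by (rule tensor_SUP_ex)
  show ?thesis
    unfolding prod_gr_def prod.case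
  proof (rule the_equality)
    show "\<forall>S. t = (SUP (a, b)\<in>S. a \<otimes> b) \<longrightarrow>
        degree (h t) = Sup01 ((\<lambda>(a, b). min (gr1 x a) (gr2 y b)) ` S)"
      by (intro allI impI) (erule ssubst, rule val)
  next
    fix r
    assume "\<forall>S. t = (SUP (a, b)\<in>S. a \<otimes> b) \<longrightarrow>
        r = Sup01 ((\<lambda>(a, b). min (gr1 x a) (gr2 y b)) ` S)"
    from this[rule_format, OF S] show "r = degree (h t)"
      unfolding S val .
  qed
qed

theorem lemma2p7p3:
  fixes X :: "'x set" and Y :: "'y set"
    and gr1 :: "'x \<Rightarrow> 'a::frame \<Rightarrow> real" and gr2 :: "'y \<Rightarrow> 'b::frame \<Rightarrow> real"
  assumes "fuzzy_topological_system X gr1" and "fuzzy_topological_system Y gr2"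
  shows "(\<forall>x\<in>X. \<forall>y\<in>Y. \<forall>(I :: 'i set) a b.
            prod_gr gr1 gr2 (x, y) (SUP i\<in>I. a i \<otimes> b i) =
              Sup01 ((\<lambda>i. min (gr1 x (a i)) (gr2 y (b i))) ` I)) \<and>
         fuzzy_topological_system (X \<times> Y) (prod_gr gr1 gr2)"
proof -
  have point: "\<exists>h. frame_hom h \<and> (\<forall>a b. degree (h (a \<otimes> b)) = min (gr1 x a) (gr2 y b)) \<and>
      (\<forall>t. prod_gr gr1 gr2 (x, y) t = degree (h t))" if "x \<in> X" "y \<in> Y" for x y
  proof -
    obtain g where g: "frame_hom g" "\<And>a. gr1 x a = degree (g a)"
      using assms(1) \<open>x \<in> X\<close> unfolding fuzzy_topological_system_iff_frame_homs by auto
    obtain k where k: "frame_hom k" "\<And>b. gr2 y b = degree (k b)"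
      using assms(2) \<open>y \<in> Y\<close> unfolding fuzzy_topological_system_iff_frame_homs by auto
    obtain h where h: "frame_hom h" "\<And>a b. h (a \<otimes> b) = inf (g a) (k b)"
      using tensor_copairing[OF g(1) k(1)] by blast
    have h_tensor: "degree (h (a \<otimes> b)) = min (gr1 x a) (gr2 y b)" for a b
      by (simp add: h(2) g(2) k(2) inf_unit_interval.rep_eq)
    show ?thesis
      by (intro exI[of _ h] conjI allI h(1) h_tensor)
        (rule prod_gr_unique[OF h(1)], rule h_tensor)
  qed
  have "prod_gr gr1 gr2 (x, y) (SUP i\<in>I. a i \<otimes> b i) =
      Sup01 ((\<lambda>i. min (gr1 x (a i)) (gr2 y (b i))) ` I)"
    if "x \<in> X" "y \<in> Y" for x y and I :: "'i set" and a b
    using point[OF that] by (auto simp: frame_hom_Sup degree_Sup image_image)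
  moreover have "fuzzy_topological_system (X \<times> Y) (prod_gr gr1 gr2)"
    unfolding fuzzy_topological_system_iff_frame_homs
  proof (intro conjI ballI)
    show "X \<times> Y \<noteq> {}" using assms by (simp add: fuzzy_topological_system_def)
  next
    fix p assume "p \<in> X \<times> Y"
    then obtain x y where p: "p = (x, y)" "x \<in> X" "y \<in> Y" by auto
    show "\<exists>h. frame_hom h \<and> (\<forall>t. prod_gr gr1 gr2 p t = degree (h t))"
      using point[OF p(2,3)] unfolding p(1) by metis
  qed
  ultimately show ?thesis by blast
qed

end
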